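(* Let $(f,\tilde f)$ be a conjugate pair of minimal surfaces with Gauss map $N:V\to\mathbb{S}^2$ on the dual $M^*$ of a discrete surface $M=(V,E,F)$, and for $\theta\in[0,2\pi]$ let $f^\theta:=\cos\theta\,f+\sin\theta\,\tilde f:V^*\to\mathbb{R}^3$ be the discrete surfaces in the associated family. Then for every interior vertex $i\in V_{int}$ (i.e. every interior face of $f^\theta$) $$H^\theta_i:=\sum_j\Big\langle dN(e_{ij})\times df^\theta(e^*_{ij}),\frac{N_i+N_j}{|N_i+N_j|^2}\Big\rangle=0,$$ $$\sum_j\langle dN(e_{ij}),df^\theta(e^*_{ij})\rangle=0.$$ Furthermore, $H^{\pi/2}$ coincides with the scalar mean curvature $\tilde H$ of the C-minimal surface $\tilde f$.
   Context: A discrete surface is a cell decomposition $M=(V,E,F)$ of an oriented surface, with or without boundary; $V_{int}$ and $E_{int}$ denote the interior vertices and interior edges. $M^*=(V^*,E^*,F^* )$ is the dual cell decomposition: elements of $V^*$ correspond to faces of $M$, and each $i\in V$ corresponds to a dual face $i^*\in F^*$. $e_{ij}$ is the oriented edge from $i$ to $j$; for an interior edge, $e_{ij}^*$ is the dual edge oriented from the right face $\phi_r$ of $e_{ij}$ to its left face $\phi_l$. For $N$ defined on $V$, $dN(e_{ij})=N_j-N_i$; for $f$ defined on $V^*$, $df(e^*_{ij})=f_{\phi_l}-f_{\phi_r}$. Sums $\sum_j$ run over the neighbors $j$ of $i$. A realization is an assignment of positions to vertices. A realization $N:V\to\mathbb{S}^2\subset\mathbb{R}^3$ is admissible if $N_i\neq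 -N_j$ for every edge $\{ij\}$. A realization $f:V^*\to\mathbb{R}^3$ is A-minimal with Gauss map $N:V\to\mathbb{S}^2$ if $N$ is admissible and for every interior edge $\{ij\}$: $dN(e_{ij})\times df(e^*_{ij})=0$ and $\langle N_i+N_j, df(e^*_{ij})\rangle=0$. A realization $\tilde f:V^*\to\mathbb{R}^3$ is C-minimal with Gauss map $N:V\to\mathbb{S}^2$ if $N$ is admissible, $\tilde f$ has planar faces with face normal $N$ (i.e. $N_i$ and $N_j$ are both orthogonal to $d\tilde f(e^*_{ij})$ for every interior edge $\{ij\}$), and the scalar mean curvature $\tilde H_i:=\sum_j |d\tilde f(e^*_{ij})|\tan\frac{\alpha_{ij}}{2}$ vanishes for every $i\in V_{int}$. Here, if $d\tilde f(e^*_{ij})\ne0$, the dihedral angle $\alpha_{ij}\in(-\pi,\pi)$ is determined by $\sin\alpha_{ij}=\langle N_i\times N_j, d\tilde f(e^*_{ij})/|d\tilde f(e^*_{ij})|\rangle$ and $\cos\alpha_{ij}=\langle N_i,N_j\rangle$; if $d\tilde f(e^*_{ij})=0$ the term is $0$. A conjugate pair of minimal surfaces with Gauss map $N$ is a pair $(f,\tilde f)$ with $f$ A-minimal and $\tilde f$ C-minimal, both with Gauss map $N$, such that $d\tilde f(e^*_{ij})=N_i\times df(e^*_{ij})=N_j\times df(e^*_{ij})$ for every interior edge $\{ij\}$. *)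

theory Defs
  imports
    "HOL-Analysis.Cross3"
    "HOL-Analysis.Cartesian_Euclidean_Space"
    "HOL-Combinatorics.Orbits"
    "Graph_Theory.Bidirected_Digraph"
begin

unbundle cross3_syntax

section \<open>Discrete surfaces\<close>

text \<open>
  A cell decomposition of an oriented surface, possibly with boundary, is given as a combinatorial
  map. The arcs of \<open>skeleton M\<close> are the oriented edges, \<open>rev_arc M\<close> reverses the orientation of an edge,
  and \<open>rot M e\<close> is the next arc after \<open>e\<close> in counterclockwise order around \<open>tail e\<close>.
  The arcs in \<open>bdry M\<close> are the oriented boundary edges with no face to their left. At a boundary
  vertex, \<open>rot M\<close> closes up the linear order of the outgoing arcs by jumping over the missing
  sector, so that every missing region appears as one formal orbit of \<open>face_succ M\<close>.
\<close>

record ('v, 'e) surface_map =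
  skeleton :: "('v, 'e) pre_digraph"
  rev_arc :: "'e \<Rightarrow> 'e"
  rot :: "'e \<Rightarrow> 'e"
  bdry :: "'e set"

abbreviation src :: "('v, 'e) surface_map \<Rightarrow> 'e \<Rightarrow> 'v" where
  "src M e \<equiv> tail (skeleton M) e"

abbreviation tgt :: "('v, 'e) surface_map \<Rightarrow> 'e \<Rightarrow> 'v" where
  "tgt M e \<equiv> head (skeleton M) e"

text \<open>
  \<open>face_succ M e\<close> is the arc after \<open>e\<close> on the boundary of the face to the left of \<open>e\<close>: the sector
  to the left of \<open>e\<close> at its head lies clockwise of the reversed arc.
\<close>

definition face_succ :: "('v, 'e) surface_map \<Rightarrow> 'e \<Rightarrow> 'e" where
  "face_succ M e = inv (rot M) (rev_arc M e)"

text \<open>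
  Multiple edges and loops are allowed. The condition \<open>vertex\<close> says that the surface is locally a
  disc at each vertex, \<open>bdry_vertex\<close> turns the disc into a half-disc at a boundary vertex,
  \<open>bdry_edge\<close> says that every edge lies in a face, and \<open>face\<close> says that every face is a polygon
  with finitely many sides, whereas boundary components may be infinite.
\<close>

locale discrete_surface =
  fixes M :: "('v, 'e) surface_map"
  assumes skeleton: "bidirected_digraph (skeleton M) (rev_arc M)"
    and rot: "rot M permutes arcs (skeleton M)"
    and vertex: "\<And>v. v \<in> verts (skeleton M) \<Longrightarrow> out_arcs (skeleton M) v \<noteq> {} \<Longrightarrow>
           cyclic_on (rot M) (out_arcs (skeleton M) v)"
    and bdry_arcs: "bdry M \<subseteq> arcs (skeleton M)"
    and bdry_succ: "\<And>e. e \<in> arcs (skeleton M) \<Longrightarrow> face_succ M e \<in> bdry M \<longleftrightarrow> e \<in> bdry M"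
    and bdry_vertex: "\<And>d e. d \<in> bdry M \<Longrightarrow> e \<in> bdry M \<Longrightarrow> src M d = src M e \<Longrightarrow> d = e"
    and bdry_edge: "\<And>e. e \<in> bdry M \<Longrightarrow> rev_arc M e \<notin> bdry M"
    and face: "\<And>e. e \<in> arcs (skeleton M) - bdry M \<Longrightarrow> e \<in> orbit (face_succ M) e"

text \<open>
  A face is represented by the set of the oriented edges that run around it counterclockwise.
  Functions on the vertices of the dual decomposition thus have type \<open>'e set \<Rightarrow> _\<close>; only their
  values at faces matter.
\<close>

definition left_face :: "('v, 'e) surface_map \<Rightarrow> 'e \<Rightarrow> 'e set" where
  "left_face M e = orbit (face_succ M) e"

definition right_face :: "('v, 'e) surface_map \<Rightarrow> 'e \<Rightarrow> 'e set" where
  "right_face M e = left_face M (rev_arc M e)"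

definition interior_arcs :: "('v, 'e) surface_map \<Rightarrow> 'e set" where
  "interior_arcs M =
     {e \<in> arcs (skeleton M). e \<notin> bdry M \<and> rev_arc M e \<notin> bdry M}"

definition interior_verts :: "('v, 'e) surface_map \<Rightarrow> 'v set" where
  "interior_verts M = {i \<in> verts (skeleton M). out_arcs (skeleton M) i \<inter> bdry M = {}}"

definition diff :: "('v, 'e) surface_map \<Rightarrow> ('v \<Rightarrow> real^3) \<Rightarrow> 'e \<Rightarrow> real^3" where
  "diff M N e = N (tgt M e) - N (src M e)"

definition dual_diff :: "('v, 'e) surface_map \<Rightarrow> ('e set \<Rightarrow> real^3) \<Rightarrow> 'e \<Rightarrow> real^3" where
  "dual_diff M f e = f (left_face M e) - f (right_face M e)"


section \<open>Discrete minimal surfaces\<close>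

definition admissible :: "('v, 'e) surface_map \<Rightarrow> ('v \<Rightarrow> real^3) \<Rightarrow> bool" where
  "admissible M N \<longleftrightarrow>
     (\<forall>i \<in> verts (skeleton M). N i \<in> sphere 0 1) \<and>
     (\<forall>e \<in> arcs (skeleton M). N (src M e) \<noteq> - N (tgt M e))"

definition A_minimal ::
  "('v, 'e) surface_map \<Rightarrow> ('v \<Rightarrow> real^3) \<Rightarrow> ('e set \<Rightarrow> real^3) \<Rightarrow> bool" where
  "A_minimal M N f \<longleftrightarrow> admissible M N \<and>
     (\<forall>e \<in> interior_arcs M.
        diff M N e \<times> dual_diff M f e = 0 \<and>
        (N (src M e) + N (tgt M e)) \<bullet> dual_diff M f e = 0)"

text \<open>Only meaningful if \<open>dual_diff M f e \<noteq> 0\<close>.\<close>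

definition dihedral_angle ::
  "('v, 'e) surface_map \<Rightarrow> ('v \<Rightarrow> real^3) \<Rightarrow> ('e set \<Rightarrow> real^3) \<Rightarrow> 'e \<Rightarrow> real" where
  "dihedral_angle M N f e =
     (THE \<alpha>. - pi < \<alpha> \<and> \<alpha> < pi \<and>
        sin \<alpha> = (N (src M e) \<times> N (tgt M e)) \<bullet> (dual_diff M f e /\<^sub>R norm (dual_diff M f e)) \<and>
        cos \<alpha> = N (src M e) \<bullet> N (tgt M e))"

text \<open>
  The sums over the neighbours \<open>j\<close> of a vertex \<open>i\<close> run over the oriented edges \<open>e\<^sub>i\<^sub>j\<close> starting
  at \<open>i\<close>. These are finitely many by \<open>vertex\<close>, and all of them are interior edges if \<open>i\<close> is an
  interior vertex.
\<close>

definition scalar_mean_curvature ::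
  "('v, 'e) surface_map \<Rightarrow> ('v \<Rightarrow> real^3) \<Rightarrow> ('e set \<Rightarrow> real^3) \<Rightarrow> 'v \<Rightarrow> real" where
  "scalar_mean_curvature M N f i =
     (\<Sum>e \<in> out_arcs (skeleton M) i.
        if dual_diff M f e = 0 then 0
        else norm (dual_diff M f e) * tan (dihedral_angle M N f e / 2))"

definition C_minimal ::
  "('v, 'e) surface_map \<Rightarrow> ('v \<Rightarrow> real^3) \<Rightarrow> ('e set \<Rightarrow> real^3) \<Rightarrow> bool" where
  "C_minimal M N f \<longleftrightarrow> admissible M N \<and>
     (\<forall>e \<in> interior_arcs M.
        N (src M e) \<bullet> dual_diff M f e = 0 \<and> N (tgt M e) \<bullet> dual_diff M f e = 0) \<and>
     (\<forall>i \<in> interior_verts M. scalar_mean_curvature M N f i = 0)"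

definition conjugate_pair ::
  "('v, 'e) surface_map \<Rightarrow> ('v \<Rightarrow> real^3) \<Rightarrow> ('e set \<Rightarrow> real^3) \<Rightarrow> ('e set \<Rightarrow> real^3) \<Rightarrow> bool" where
  "conjugate_pair M N f g \<longleftrightarrow> A_minimal M N f \<and> C_minimal M N g \<and>
     (\<forall>e \<in> interior_arcs M.
        dual_diff M g e = N (src M e) \<times> dual_diff M f e \<and>
        dual_diff M g e = N (tgt M e) \<times> dual_diff M f e)"

definition associated_family ::
  "('e set \<Rightarrow> real^3) \<Rightarrow> ('e set \<Rightarrow> real^3) \<Rightarrow> real \<Rightarrow> 'e set \<Rightarrow> real^3" where
  "associated_family f g \<theta> = (\<lambda>\<phi>. cos \<theta> *\<^sub>R f \<phi> + sin \<theta> *\<^sub>R g \<phi>)"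

definition mean_curvature ::
  "('v, 'e) surface_map \<Rightarrow> ('v \<Rightarrow> real^3) \<Rightarrow> ('e set \<Rightarrow> real^3) \<Rightarrow> 'v \<Rightarrow> real" where
  "mean_curvature M N f i =
     (\<Sum>e \<in> out_arcs (skeleton M) i.
        (diff M N e \<times> dual_diff M f e) \<bullet>
        ((N (src M e) + N (tgt M e)) /\<^sub>R (norm (N (src M e) + N (tgt M e)))\<^sup>2))"

end

theory Submission
  imports Defs
begin

text \<open>
  For an edge with end normals \<open>a\<close>, \<open>b\<close> write \<open>x\<close> and \<open>y\<close> for the dual edge vectors of the
  A-minimal and the C-minimal surface; the dual edge vector of the associated family is
  \<open>cos \<theta> *\<^sub>R x + sin \<theta> *\<^sub>R y\<close>, so both sums split into a part from \<open>x\<close> and a part from \<open>y\<close>.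

  In the mean curvature, \<open>x\<close> contributes nothing, as \<open>(b - a) \<times> x = 0\<close>. The contribution of \<open>y\<close>
  is \<open>2 * (y \<bullet> (a \<times> b)) / (norm (a + b))\<^sup>2\<close>, and because \<open>a \<times> b\<close> is parallel to \<open>y\<close> this is the
  half-angle formula \<open>tan (\<alpha> / 2) = sin \<alpha> / (1 + cos \<alpha>)\<close> for the dihedral angle \<open>\<alpha>\<close>, scaled by
  \<open>norm y\<close>. So the mean curvature of the associated surface is \<open>sin \<theta>\<close> times the scalar mean
  curvature of the C-minimal surface, which vanishes.

  In the sum of the scalar products, \<open>y\<close> contributes nothing because it is orthogonal to \<open>a\<close> and
  \<open>b\<close>, and \<open>(b - a) \<bullet> x = - 2 * (a \<bullet> x)\<close> since \<open>(a + b) \<bullet> x = 0\<close>. The normal \<open>a\<close> is the same for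
  all edges at a vertex, so what remains is its product with the sum of the dual edge vectors
  around the vertex. These are the sides of a closed polygon, the dual face, and add up to zero.
\<close>

section \<open>The dual face of an interior vertex\<close>

context discrete_surface
begin

sublocale bidirected_digraph "skeleton M" "rev_arc M"
  by (rule skeleton)

lemma face_succ_rev_arc: "face_succ M (rev_arc M e) = inv (rot M) e"
  by (simp add: face_succ_def)

lemma bij_betw_inv_rot_out_arcs:
  assumes "i \<in> verts (skeleton M)"
  shows "bij_betw (inv (rot M)) (out_arcs (skeleton M) i) (out_arcs (skeleton M) i)"
proof (cases "out_arcs (skeleton M) i = {}")
  case False
  let ?O = "out_arcs (skeleton M) i"
  have cyclic: "cyclic_on (rot M) ?O"
    using vertex[OF assms False] .
  have "inj_on (rot M) ?O"
    using permutes_inj[OF rot] by (rule inj_on_subset) simp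
  moreover have "rot M ` ?O \<subseteq> ?O"
    using cyclic_on_inI[OF cyclic] by blast
  ultimately have "bij_betw (rot M) ?O ?O"
    using finite_cyclic_on[OF cyclic] by (simp add: bij_betw_def endo_inj_surj)
  then have "rot M ` ?O = ?O"
    by (simp add: bij_betw_def)
  then have "inv (rot M) ` ?O = ?O"
    using image_inv_f_f[OF permutes_inj[OF rot], of ?O] by simp
  moreover have "inj_on (inv (rot M)) ?O"
    using permutes_inj[OF permutes_inv[OF rot]] by (rule inj_on_subset) simp
  ultimately show ?thesis
    by (simp add: bij_betw_def)
qed (simp add: bij_betw_def)

text \<open>
  The arc after the reverse of \<open>e\<close> on its face again starts at \<open>i\<close>, so it is not a boundary arc,
  and the arcs around a face are either all boundary arcs or none of them is.
\<close>

lemma out_arcs_interior: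
  assumes "i \<in> interior_verts M"
  shows "out_arcs (skeleton M) i \<subseteq> interior_arcs M"
proof
  fix e assume e: "e \<in> out_arcs (skeleton M) i"
  have i: "i \<in> verts (skeleton M)" "out_arcs (skeleton M) i \<inter> bdry M = {}"
    using assms by (auto simp: interior_verts_def)
  have "face_succ M (rev_arc M e) \<in> out_arcs (skeleton M) i"
    using bij_betwE[OF bij_betw_inv_rot_out_arcs[OF i(1)]] e by (simp only: face_succ_rev_arc)
  then have "rev_arc M e \<notin> bdry M"
    using bdry_succ[of "rev_arc M e"] e i(2) by auto
  then show "e \<in> interior_arcs M"
    using e i(2) by (auto simp: interior_arcs_def)
qed

lemma right_face_eq_left_face:
  assumes "e \<in> interior_arcs M"
  shows "right_face M e = left_face M (inv (rot M) e)"
proof -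
  have "rev_arc M e \<in> orbit (face_succ M) (rev_arc M e)"
    using assms by (intro face) (auto simp: interior_arcs_def)
  then have "orbit (face_succ M) (face_succ M (rev_arc M e)) = orbit (face_succ M) (rev_arc M e)"
    by (rule self_in_orbit_step)
  then show ?thesis
    by (simp add: right_face_def left_face_def face_succ_rev_arc)
qed

text \<open>
  The face to the right of an arc at \<open>i\<close> is the face to the left of the preceding arc, so the
  differences cancel cyclically.
\<close>

lemma sum_dual_diff_eq_0:
  assumes "i \<in> interior_verts M"
  shows "(\<Sum>e \<in> out_arcs (skeleton M) i. dual_diff M f e) = 0"
proof -
  let ?O = "out_arcs (skeleton M) i"
  have "i \<in> verts (skeleton M)"
    using assms by (simp add: interior_verts_def)
  then have "(\<Sum>e \<in> ?O. f (left_face M (inv (rot M) e))) = (\<Sum>e \<in> ?O. f (left_face M e))"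
    by (intro sum.reindex_bij_betw bij_betw_inv_rot_out_arcs)
  moreover have "(\<Sum>e \<in> ?O. f (right_face M e)) = (\<Sum>e \<in> ?O. f (left_face M (inv (rot M) e)))"
    using out_arcs_interior[OF assms] by (intro sum.cong) (auto simp: right_face_eq_left_face)
  ultimately show ?thesis
    by (simp add: dual_diff_def sum_subtractf)
qed

end


section \<open>The half-angle formula for an edge\<close>

lemma inner_unit_sum_pos:
  fixes a b :: "'a::real_inner"
  assumes "norm a = 1" "norm b = 1" "a \<noteq> - b"
  shows "1 + a \<bullet> b > 0"
proof -
  have "(norm (a + b))\<^sup>2 = 2 * (1 + a \<bullet> b)"
    using assms by (simp add: power2_norm_eq_inner inner_add inner_commute norm_eq_1)
  moreover have "a + b \<noteq> 0"
    using assms(3) by (simp add: eq_neg_iff_add_eq_0)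
  ultimately show ?thesis
    using zero_less_power2[of "norm (a + b)"] by (simp only: norm_eq_zero) simp
qed

text \<open>
  Excluding \<open>c = - 1\<close> keeps the angle off the end point \<open>pi\<close>. Uniqueness is a consequence of the
  half-angle formula, which recovers the angle from its sine and cosine.
\<close>

lemma tan_half_the_angle:
  fixes s c :: real
  assumes "s\<^sup>2 + c\<^sup>2 = 1" "1 + c > 0"
  shows "tan ((THE \<alpha>. - pi < \<alpha> \<and> \<alpha> < pi \<and> sin \<alpha> = s \<and> cos \<alpha> = c) / 2) = s / (1 + c)"
proof -
  let ?P = "\<lambda>\<alpha>. - pi < \<alpha> \<and> \<alpha> < pi \<and> sin \<alpha> = s \<and> cos \<alpha> = c"
  have tan: "tan (\<alpha> / 2) = s / (1 + c)" if "?P \<alpha>" for \<alpha>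
    using that tan_half[of "\<alpha> / 2"] by (simp add: add.commute)
  have unique: "\<alpha> = 2 * arctan (s / (1 + c))" if "?P \<alpha>" for \<alpha>
    using arctan_tan[of "\<alpha> / 2"] tan[OF that] that by simp
  obtain t where t: "c = cos t" "s = sin t"
    using sincos_total_2pi[of c s] assms(1) by (auto simp: add.commute)
  obtain \<alpha> where \<alpha>: "- pi < \<alpha>" "\<alpha> \<le> pi" "sin \<alpha> = s" "cos \<alpha> = c"
    using sincos_principal_value[of t] t by auto
  have "\<alpha> \<noteq> pi"
    using assms(2) \<alpha>(4) by auto
  then have P: "?P \<alpha>"
    using \<alpha> by simp
  have "\<exists>!\<alpha>. ?P \<alpha>"
  proof (rule ex1I)
    show "?P \<alpha>"
      by (rule P)
    show "\<beta> = \<alpha>" if "?P \<beta>" for \<beta>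
      using unique[OF that] unique[OF P] by (rule trans[OF _ sym])
  qed
  then show ?thesis
    by (rule tan[OF theI'])
qed

text \<open>
  The values prescribed for the sine and the cosine of the dihedral angle are compatible since
  \<open>a \<times> b\<close> is parallel to the edge vector \<open>y\<close>, so that projecting it onto \<open>y\<close> preserves its length.
\<close>

lemma inner_cross_sgn_squared:
  fixes a b y :: "real^3"
  assumes "norm a = 1" "norm b = 1" "a \<bullet> y = 0" "b \<bullet> y = 0" "y \<noteq> 0"
  shows "((a \<times> b) \<bullet> (y /\<^sub>R norm y))\<^sup>2 + (a \<bullet> b)\<^sup>2 = 1"
proof -
  have "(a \<times> b) \<times> y = (a \<bullet> y) *\<^sub>R b - (b \<bullet> y) *\<^sub>R a"
    by (simp add: vec_eq_iff forall_3 cross_components inner_vec_def sum_3 algebra_simps)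
  then have "((a \<times> b) \<bullet> y)\<^sup>2 = (norm (a \<times> b))\<^sup>2 * (norm y)\<^sup>2"
    using norm_cross_dot[of "a \<times> b" y] assms by (simp add: power_mult_distrib)
  then have "((a \<times> b) \<bullet> (y /\<^sub>R norm y))\<^sup>2 = (norm (a \<times> b))\<^sup>2"
    using assms(5) by (simp add: power_mult_distrib power_inverse field_simps)
  then show ?thesis
    using norm_cross_dot[of a b] assms(1,2) by simp
qed

lemma edge_mean_curvature_cross:
  fixes a b y :: "real^3"
  assumes "norm a = 1" "norm b = 1"
  shows "((b - a) \<times> y) \<bullet> ((a + b) /\<^sub>R (norm (a + b))\<^sup>2) = ((a \<times> b) \<bullet> y) / (1 + a \<bullet> b)"
proof -
  have "((b - a) \<times> y) \<bullet> (a + b) = 2 * ((a \<times> b) \<bullet> y)"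
    by (simp add: cross3_simps)
  moreover have "(norm (a + b))\<^sup>2 = 2 * (1 + a \<bullet> b)"
    using assms by (simp add: power2_norm_eq_inner inner_add inner_commute norm_eq_1)
  moreover have "inverse (2 * z) * (2 * w) = w / z" for w z :: real
    by (cases "z = 0") (simp_all add: field_simps)
  ultimately show ?thesis
    by (simp only: inner_scaleR_right)
qed


section \<open>Curvature of the associated family\<close>

lemma dual_diff_associated_family:
  "dual_diff M (associated_family f g \<theta>) e =
     cos \<theta> *\<^sub>R dual_diff M f e + sin \<theta> *\<^sub>R dual_diff M g e"
  by (simp add: dual_diff_def associated_family_def algebra_simps)

lemma admissible_arcD:
  assumes "discrete_surface M" "admissible M N" "e \<in> arcs (skeleton M)"
  shows "norm (N (src M e)) = 1" "norm (N (tgt M e)) = 1" "N (src M e) \<noteq> - N (tgt M e)"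
proof -
  interpret discrete_surface M by fact
  show "norm (N (src M e)) = 1" "norm (N (tgt M e)) = 1" "N (src M e) \<noteq> - N (tgt M e)"
    using assms(2,3) by (auto simp: admissible_def)
qed

lemma mean_curvature_eq_scalar_mean_curvature:
  assumes "discrete_surface M" "C_minimal M N g" "i \<in> interior_verts M"
  shows "mean_curvature M N g i = scalar_mean_curvature M N g i"
  unfolding mean_curvature_def scalar_mean_curvature_def
proof (intro sum.cong refl)
  fix e assume e: "e \<in> out_arcs (skeleton M) i"
  let ?a = "N (src M e)" and ?b = "N (tgt M e)" and ?y = "dual_diff M g e"
  have "e \<in> interior_arcs M"
    using discrete_surface.out_arcs_interior[OF assms(1,3)] e by blast
  then have orth: "?a \<bullet> ?y = 0" "?b \<bullet> ?y = 0"
    using assms(2) by (auto simp: C_minimal_def)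
  have unit: "norm ?a = 1" "norm ?b = 1" "?a \<noteq> - ?b"
    using admissible_arcD[OF assms(1)] assms(2) e by (auto simp: C_minimal_def)
  have "((?a \<times> ?b) \<bullet> ?y) / (1 + ?a \<bullet> ?b) =
      (if ?y = 0 then 0 else norm ?y * tan (dihedral_angle M N g e / 2))"
    using tan_half_the_angle[OF inner_cross_sgn_squared[OF unit(1,2) orth] inner_unit_sum_pos[OF unit]]
    by (auto simp: dihedral_angle_def)
  then show "(diff M N e \<times> ?y) \<bullet> ((?a + ?b) /\<^sub>R (norm (?a + ?b))\<^sup>2) =
      (if ?y = 0 then 0 else norm ?y * tan (dihedral_angle M N g e / 2))"
    unfolding diff_def edge_mean_curvature_cross[OF unit(1,2)] .
qed

lemma mean_curvature_associated_family:
  assumes "discrete_surface M" "A_minimal M N f" "i \<in> interior_verts M"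
  shows "mean_curvature M N (associated_family f g \<theta>) i = sin \<theta> * mean_curvature M N g i"
  unfolding mean_curvature_def sum_distrib_left
proof (intro sum.cong refl)
  fix e assume "e \<in> out_arcs (skeleton M) i"
  then have "e \<in> interior_arcs M"
    using discrete_surface.out_arcs_interior[OF assms(1,3)] by blast
  then have "diff M N e \<times> dual_diff M f e = 0"
    using assms(2) by (simp add: A_minimal_def)
  then show "(diff M N e \<times> dual_diff M (associated_family f g \<theta>) e) \<bullet>
        ((N (src M e) + N (tgt M e)) /\<^sub>R (norm (N (src M e) + N (tgt M e)))\<^sup>2) =
      sin \<theta> * ((diff M N e \<times> dual_diff M g e) \<bullet>
        ((N (src M e) + N (tgt M e)) /\<^sub>R (norm (N (src M e) + N (tgt M e)))\<^sup>2))"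
    by (simp add: dual_diff_associated_family cross_add_right cross_mult_right)
qed

lemma sum_diff_inner_associated_family:
  assumes "discrete_surface M" "A_minimal M N f" "C_minimal M N g" "i \<in> interior_verts M"
  shows "(\<Sum>e \<in> out_arcs (skeleton M) i.
            diff M N e \<bullet> dual_diff M (associated_family f g \<theta>) e) = 0"
proof -
  let ?O = "out_arcs (skeleton M) i"
  have "diff M N e \<bullet> dual_diff M (associated_family f g \<theta>) e =
      (- 2 * cos \<theta>) * (N i \<bullet> dual_diff M f e)" if e: "e \<in> ?O" for e
  proof -
    have int: "e \<in> interior_arcs M"
      using discrete_surface.out_arcs_interior[OF assms(1,4)] e by blast
    have src: "src M e = i"
      using e by simp
    have "N i \<bullet> dual_diff M f e + N (tgt M e) \<bullet> dual_diff M f e = 0"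
      using int assms(2) src by (auto simp: A_minimal_def inner_add_left)
    then have "N (tgt M e) \<bullet> dual_diff M f e = - (N i \<bullet> dual_diff M f e)"
      by simp
    moreover have "N i \<bullet> dual_diff M g e = 0" "N (tgt M e) \<bullet> dual_diff M g e = 0"
      using int assms(3) src by (auto simp: C_minimal_def)
    ultimately show ?thesis
      by (simp add: diff_def src dual_diff_associated_family inner_add_right inner_diff_left)
  qed
  then have "(\<Sum>e \<in> ?O. diff M N e \<bullet> dual_diff M (associated_family f g \<theta>) e) =
      (- 2 * cos \<theta>) * (N i \<bullet> (\<Sum>e \<in> ?O. dual_diff M f e))"
    by (simp add: inner_sum_right sum_distrib_left)
  then show ?thesis
    by (simp add: discrete_surface.sum_dual_diff_eq_0[OF assms(1,4)])
qed

theorem corollary4p4p1: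
  fixes M :: "('v, 'e) surface_map"
    and N :: "'v \<Rightarrow> real^3"
    and f f' :: "'e set \<Rightarrow> real^3"
  assumes "discrete_surface M"
    and "conjugate_pair M N f f'"
  shows "(\<forall>\<theta> \<in> {0..2 * pi}. \<forall>i \<in> interior_verts M.
            mean_curvature M N (associated_family f f' \<theta>) i = 0 \<and>
            (\<Sum>e \<in> out_arcs (skeleton M) i.
               diff M N e \<bullet> dual_diff M (associated_family f f' \<theta>) e) = 0) \<and>
         (\<forall>i \<in> interior_verts M.
            mean_curvature M N (associated_family f f' (pi / 2)) i = scalar_mean_curvature M N f' i)"
proof -
  have minimal: "A_minimal M N f" "C_minimal M N f'"
    using assms(2) by (auto simp: conjugate_pair_def)
  have H: "mean_curvature M N (associated_family f f' \<theta>) i = sin \<theta> * scalar_mean_curvature M N f' i"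
    if "i \<in> interior_verts M" for \<theta> i
    by (simp only: mean_curvature_associated_family[OF assms(1) minimal(1) that]
        mean_curvature_eq_scalar_mean_curvature[OF assms(1) minimal(2) that])
  have zero: "scalar_mean_curvature M N f' i = 0" if "i \<in> interior_verts M" for i
    using minimal(2) that by (simp add: C_minimal_def)
  show ?thesis
    by (intro conjI ballI) (simp_all add: H zero
        sum_diff_inner_associated_family[OF assms(1) minimal])
qed

end
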